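(* Let $\bar{X} = (X,\Sigma_X,\mathbb{P}_X)$, $\bar{Y} = (Y,\Sigma_Y,\mathbb{P}_Y)$ and $\bar{Z} = (Z,\Sigma_Z,\mathbb{P}_Z)$ be probability spaces, and let $g : \bar{Z} \to \bar{Y}$ and $f : \bar{Y} \to \bar{X}$ be null-preserving functions. Then $f \circ g : \bar{Z} \to \bar{X}$ is also null-preserving.
   Context: For probability spaces $\bar{X} = (X,\Sigma_X,\mathbb{P}_X)$ and $\bar{Y} = (Y,\Sigma_Y,\mathbb{P}_Y)$, a measurable function $f : \bar{Y} \to \bar{X}$ (that is, a $\Sigma_Y/\Sigma_X$-measurable function $f : Y \to X$) is called null-preserving if for every $A \in \Sigma_X$ with $\mathbb{P}_X(A) = 0$ one has $\mathbb{P}_Y(f^{-1}(A)) = 0$. *)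

theory Defs
  imports "HOL-Probability.Probability_Measure"
begin

(* The preimage is cut down to the carrier of N, since HOL functions are total on the type. *)
definition null_preserving :: "'b measure \<Rightarrow> 'a measure \<Rightarrow> ('b \<Rightarrow> 'a) \<Rightarrow> bool" where
  "null_preserving N M f \<longleftrightarrow>
     f \<in> measurable N M \<and>
     (\<forall>A \<in> sets M. emeasure M A = 0 \<longrightarrow> emeasure N (f -` A \<inter> space N) = 0)"

end

theory Submission
  imports Defs
begin

text \<open>Preimages compose contravariantly: a null set of \<open>X\<close> is pulled back first
  along \<open>f\<close>, then along \<open>g\<close>. Measurability of \<open>f\<close> makes the
  intermediate preimage a member of \<open>sets Y\<close>, and it is null there, so the hypothesis
  on \<open>g\<close> applies to it.\<close>

theorem proposition2p5:
  fixes X :: "'x measure" and Y :: "'y measure" and Z :: "'z measure"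
    and f :: "'y \<Rightarrow> 'x" and g :: "'z \<Rightarrow> 'y"
  assumes "prob_space X" and "prob_space Y" and "prob_space Z"
    and "null_preserving Z Y g" and "null_preserving Y X f"
  shows "null_preserving Z X (f \<circ> g)"
proof -
  have g: "g \<in> measurable Z Y"
    and g0: "\<And>B. B \<in> sets Y \<Longrightarrow> emeasure Y B = 0 \<Longrightarrow> emeasure Z (g -` B \<inter> space Z) = 0"
    using assms(4) by (auto simp: null_preserving_def)
  have f: "f \<in> measurable Y X"
    and f0: "\<And>A. A \<in> sets X \<Longrightarrow> emeasure X A = 0 \<Longrightarrow> emeasure Y (f -` A \<inter> space Y) = 0"
    using assms(5) by (auto simp: null_preserving_def)
  have "emeasure Z ((f \<circ> g) -` A \<inter> space Z) = 0" if A: "A \<in> sets X" "emeasure X A = 0" for A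
  proof -
    \<comment> \<open>Cutting down to \<open>space Y\<close> loses no points, since \<open>g\<close>
      maps \<open>space Z\<close> into \<open>space Y\<close>; it gives the inner set the form in
      which \<open>f\<close> yields a measurable null set.\<close>
    have "(f \<circ> g) -` A \<inter> space Z = g -` (f -` A \<inter> space Y) \<inter> space Z"
      using measurable_space[OF g] by auto
    then show ?thesis
      using g0[OF measurable_sets[OF f A(1)] f0[OF A]] by simp
  qed
  then show ?thesis
    using measurable_comp[OF g f] by (simp add: null_preserving_def)
qed

end
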